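(* There exist finite pointed models $\mathcal{M}_k$, for $k \geq 0$, such that the rooted $k$-contraction of $\mathcal{M}_k$ (with respect to $k$) has $\Theta(k)$ worlds whereas the standard $k$-contraction of $\mathcal{M}_k$ has $\Theta(2^k)$ worlds.
   Context: A model is $M=(W,R,V)$ with $W$ finite nonempty, a relation $R_i\subseteq W\times W$ for each index $i$ of a finite set $\mathcal{I}$, and $V$ assigning to each atomic proposition (from a countable set $\mathcal{P}$) a subset of $W$; a pointed model is $(M,w_d)$ with $w_d\in W$. $\sim_h$ is standard $h$-bounded bisimilarity (sequence $Z_h\subseteq\dots\subseteq Z_0$ of nonempty relations containing the designated pair in $Z_h$, atom agreement on $Z_0$, forth and back conditions from $Z_{j+1}$ to $Z_j$ for $j<h$); for worlds of one model, $w\sim_h v$ means $(M,w)\sim_h(M,v)$ and $[w]_h=\{v\in W\mid w\sim_hv\}$. The standard $k$-contraction of $((W,R,V),w_d)$ is the quotient by $\sim_k$: worlds $\{[w]_k\mid w\in W\}$, $R'_i=\{([w]_k,[v]_k)\mid wR_iv\}$, $V'(p)=\{[w]_k\mid w\in V(p)\}$, designated world $[w_d]_k$. For the rooted $k$-contraction: depth $d(w)$ = length of a shortest path from $w_d$ to $w$ along edges of any $R_i$ ($\infty$ if none); bound $b(w)=k-d(w)$; for $x,y$ with nonnegative bound, $x\succ y$ iff $b(x)>b(y)$ and $x\sim_{b(y)}y$; $\mathrm{Max}(W)=\{x\in W\mid b(x)\ge0$ and no $y\in W$ has $y\succ x\}$; the rooted $k$-contraction is $((W',R',V'),[w_d]_{b(w_d)})$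 with $W'=\{[x]_{b(x)}\mid x\in\mathrm{Max}(W)\}$, $R'_i=\{([x]_{b(x)},[y]_{b(y)})\mid x,y\in\mathrm{Max}(W),\ \exists z\,(xR_iz\text{ and }y\sim_{b(x)-1}z),\ b(x)>0\}$, $V'(p)=\{[x]_{b(x)}\mid x\in\mathrm{Max}(W),\ x\in V(p)\}$. *)

theory Defs
  imports Complex_Main "HOL-Library.Landau_Symbols" "HOL-Library.Countable_Set"
    "HOL-Library.Extended_Nat"
begin

text \<open>
  The index set \<open>I\<close> and the set \<open>P\<close> of atomic propositions are explicit parameters; the values
  of \<open>rel\<close> outside \<open>I\<close> and of \<open>val\<close> outside \<open>P\<close> are never consulted.
\<close>

record ('w, 'i, 'p) model =
  worlds :: "'w set"
  rel :: "'i \<Rightarrow> ('w \<times> 'w) set"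
  val :: "'p \<Rightarrow> 'w set"

type_synonym ('w, 'i, 'p) pointed = "('w, 'i, 'p) model \<times> 'w"

definition is_model :: "'i set \<Rightarrow> 'p set \<Rightarrow> ('w, 'i, 'p) model \<Rightarrow> bool" where
  "is_model I P M \<longleftrightarrow>
     finite (worlds M) \<and> worlds M \<noteq> {} \<and>
     (\<forall>i\<in>I. rel M i \<subseteq> worlds M \<times> worlds M) \<and>
     (\<forall>p\<in>P. val M p \<subseteq> worlds M)"

definition is_pointed_model :: "'i set \<Rightarrow> 'p set \<Rightarrow> ('w, 'i, 'p) pointed \<Rightarrow> bool" where
  "is_pointed_model I P Mw \<longleftrightarrow> is_model I P (fst Mw) \<and> snd Mw \<in> worlds (fst Mw)"


subsection \<open>Bounded bisimilarity\<close>

definition bounded_bisimulation ::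
  "'i set \<Rightarrow> 'p set \<Rightarrow> nat \<Rightarrow> ('w, 'i, 'p) pointed \<Rightarrow> ('v, 'i, 'p) pointed \<Rightarrow>
     (nat \<Rightarrow> ('w \<times> 'v) set) \<Rightarrow> bool" where
  "bounded_bisimulation I P h Mw Nv Z \<longleftrightarrow>
     (let M = fst Mw; N = fst Nv in
       (\<forall>j\<le>h. Z j \<noteq> {} \<and> Z j \<subseteq> worlds M \<times> worlds N) \<and>
       (\<forall>j<h. Z (Suc j) \<subseteq> Z j) \<and>
       (snd Mw, snd Nv) \<in> Z h \<and>
       (\<forall>(x, y)\<in>Z 0. \<forall>p\<in>P. x \<in> val M p \<longleftrightarrow> y \<in> val N p) \<and>
       (\<forall>j<h. \<forall>(x, y)\<in>Z (Suc j). \<forall>i\<in>I.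
          (\<forall>x'. (x, x') \<in> rel M i \<longrightarrow> (\<exists>y'. (y, y') \<in> rel N i \<and> (x', y') \<in> Z j)) \<and>
          (\<forall>y'. (y, y') \<in> rel N i \<longrightarrow> (\<exists>x'. (x, x') \<in> rel M i \<and> (x', y') \<in> Z j))))"

definition bounded_bisimilar ::
  "'i set \<Rightarrow> 'p set \<Rightarrow> nat \<Rightarrow> ('w, 'i, 'p) pointed \<Rightarrow> ('v, 'i, 'p) pointed \<Rightarrow> bool" where
  "bounded_bisimilar I P h Mw Nv \<longleftrightarrow> (\<exists>Z. bounded_bisimulation I P h Mw Nv Z)"

definition world_bisim ::
  "'i set \<Rightarrow> 'p set \<Rightarrow> ('w, 'i, 'p) model \<Rightarrow> nat \<Rightarrow> 'w \<Rightarrow> 'w \<Rightarrow> bool" where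
  "world_bisim I P M h w v \<longleftrightarrow> bounded_bisimilar I P h (M, w) (M, v)"

definition bisim_class ::
  "'i set \<Rightarrow> 'p set \<Rightarrow> ('w, 'i, 'p) model \<Rightarrow> nat \<Rightarrow> 'w \<Rightarrow> 'w set" where
  "bisim_class I P M h w = {v \<in> worlds M. world_bisim I P M h w v}"


subsection \<open>Standard contraction\<close>

definition standard_contraction ::
  "'i set \<Rightarrow> 'p set \<Rightarrow> nat \<Rightarrow> ('w, 'i, 'p) pointed \<Rightarrow> ('w set, 'i, 'p) pointed" where
  "standard_contraction I P k Mw =
     (let M = fst Mw; c = bisim_class I P M k in
       (\<lparr>worlds = {c w | w. w \<in> worlds M},
         rel = (\<lambda>i. {(c w, c v) | w v. (w, v) \<in> rel M i}),
         val = (\<lambda>p. {c w | w. w \<in> val M p})\<rparr>,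
        c (snd Mw)))"


subsection \<open>Rooted contraction\<close>

text \<open>The infimum of the empty set in \<^typ>\<open>enat\<close> is infinity, so unreachable worlds get depth
  infinity.\<close>

definition depth :: "'i set \<Rightarrow> ('w, 'i, 'p) pointed \<Rightarrow> 'w \<Rightarrow> enat" where
  "depth I Mw w = (INF n\<in>{n. (snd Mw, w) \<in> (\<Union>i\<in>I. rel (fst Mw) i) ^^ n}. enat n)"

text \<open>The bound of a world is \<open>k\<close> minus its depth. It is non-negative iff the depth is at most
  \<open>k\<close>, which is what \<open>nonneg_bound\<close> says; the natural number \<open>bound\<close> is the bound for such worlds,
  and is used below for such worlds only.\<close>

definition nonneg_bound :: "'i set \<Rightarrow> nat \<Rightarrow> ('w, 'i, 'p) pointed \<Rightarrow> 'w \<Rightarrow> bool" where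
  "nonneg_bound I k Mw w \<longleftrightarrow> depth I Mw w \<le> enat k"

definition bound :: "'i set \<Rightarrow> nat \<Rightarrow> ('w, 'i, 'p) pointed \<Rightarrow> 'w \<Rightarrow> nat" where
  "bound I k Mw w = k - the_enat (depth I Mw w)"

definition outranks ::
  "'i set \<Rightarrow> 'p set \<Rightarrow> nat \<Rightarrow> ('w, 'i, 'p) pointed \<Rightarrow> 'w \<Rightarrow> 'w \<Rightarrow> bool" where
  "outranks I P k Mw x y \<longleftrightarrow>
     nonneg_bound I k Mw x \<and> nonneg_bound I k Mw y \<and>
     bound I k Mw x > bound I k Mw y \<and>
     world_bisim I P (fst Mw) (bound I k Mw y) x y"

definition max_worlds :: "'i set \<Rightarrow> 'p set \<Rightarrow> nat \<Rightarrow> ('w, 'i, 'p) pointed \<Rightarrow> 'w set" where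
  "max_worlds I P k Mw =
     {x \<in> worlds (fst Mw). nonneg_bound I k Mw x \<and>
        \<not> (\<exists>y\<in>worlds (fst Mw). outranks I P k Mw y x)}"

definition rooted_contraction ::
  "'i set \<Rightarrow> 'p set \<Rightarrow> nat \<Rightarrow> ('w, 'i, 'p) pointed \<Rightarrow> ('w set, 'i, 'p) pointed" where
  "rooted_contraction I P k Mw =
     (let M = fst Mw;
          b = bound I k Mw;
          X = max_worlds I P k Mw;
          c = (\<lambda>x. bisim_class I P M (b x) x) in
       (\<lparr>worlds = {c x | x. x \<in> X},
         rel = (\<lambda>i. {(c x, c y) | x y. x \<in> X \<and> y \<in> X \<and>
                  (\<exists>z. (x, z) \<in> rel M i \<and> world_bisim I P M (b x - 1) y z) \<and> b x > 0}),
         val = (\<lambda>p. {c x | x. x \<in> X \<and> x \<in> val M p})\<rparr>,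
        c (snd Mw)))"

end

(* The root of M_k sees every world of a chain k - 1 -> ... -> 1 -> 0, and it starts a path of
   length k whose last world sees one world for every subset S of {0, ..., k - 1}; that world sees
   exactly the chain worlds in S. Different chain worlds differ already at modal depth k - 1, so the
   2 ^ k subset worlds are pairwise distinguishable at depth k and all survive in the standard
   contraction. They have depth k + 1, so the rooted contraction ignores them: only the root path
   and the chain, O(k) worlds, can contribute. The chain worlds have depth 1, hence bound k - 1,
   which is enough to keep k - 1 of them apart. *)

theory Submission imports Defs begin

section \<open>Bounded bisimilarity and depth\<close>

lemma bounded_bisimulation_iff:
  "bounded_bisimulation I P h (M, a) (N, b) Z \<longleftrightarrow>
     (\<forall>j\<le>h. Z j \<noteq> {} \<and> Z j \<subseteq> worlds M \<times> worlds N) \<and>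
     (\<forall>j<h. Z (Suc j) \<subseteq> Z j) \<and>
     (a, b) \<in> Z h \<and>
     (\<forall>x y p. (x, y) \<in> Z 0 \<longrightarrow> p \<in> P \<longrightarrow> (x \<in> val M p \<longleftrightarrow> y \<in> val N p)) \<and>
     (\<forall>j x y i. j < h \<longrightarrow> (x, y) \<in> Z (Suc j) \<longrightarrow> i \<in> I \<longrightarrow>
        (\<forall>x'. (x, x') \<in> rel M i \<longrightarrow> (\<exists>y'. (y, y') \<in> rel N i \<and> (x', y') \<in> Z j)) \<and>
        (\<forall>y'. (y, y') \<in> rel N i \<longrightarrow> (\<exists>x'. (x, x') \<in> rel M i \<and> (x', y') \<in> Z j)))"
  by (simp add: bounded_bisimulation_def Ball_def)

lemma world_bisim_refl:
  assumes "is_model I P M" "w \<in> worlds M"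
  shows "world_bisim I P M h w w"
proof -
  have "bounded_bisimulation I P h (M, w) (M, w) (\<lambda>_. Id_on (worlds M))"
    using assms by (auto simp: bounded_bisimulation_iff is_model_def)
  then show ?thesis
    by (auto simp: world_bisim_def bounded_bisimilar_def)
qed

lemma world_bisim_sym:
  assumes "world_bisim I P M h w v"
  shows "world_bisim I P M h v w"
proof -
  obtain Z where Z: "bounded_bisimulation I P h (M, w) (M, v) Z"
    using assms by (auto simp: world_bisim_def bounded_bisimilar_def)
  have "Z j \<noteq> {}" "Z j \<subseteq> worlds M \<times> worlds M" if "j \<le> h" for j
    using Z that by (auto simp: bounded_bisimulation_iff)
  then have "(Z j)\<inverse> \<noteq> {} \<and> (Z j)\<inverse> \<subseteq> worlds M \<times> worlds M" if "j \<le> h" for j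
    using that by fast
  then have "bounded_bisimulation I P h (M, v) (M, w) (\<lambda>j. (Z j)\<inverse>)"
    using Z unfolding bounded_bisimulation_iff by simp
  then show ?thesis
    by (auto simp: world_bisim_def bounded_bisimilar_def)
qed

text \<open>The family \<open>Z\<close> that witnesses level \<open>Suc h\<close> also serves the
  successors at level \<open>h\<close>, once its top layer is dropped.\<close>

lemma world_bisim_forth:
  assumes "world_bisim I P M (Suc h) w v" "i \<in> I" "(w, w') \<in> rel M i"
  obtains v' where "(v, v') \<in> rel M i" "world_bisim I P M h w' v'"
proof -
  obtain Z where Z: "bounded_bisimulation I P (Suc h) (M, w) (M, v) Z"
    using assms by (auto simp: world_bisim_def bounded_bisimilar_def)
  then obtain v' where v': "(v, v') \<in> rel M i" "(w', v') \<in> Z h"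
    using assms unfolding bounded_bisimulation_iff by blast
  then have "bounded_bisimulation I P h (M, w') (M, v') Z"
    using Z unfolding bounded_bisimulation_iff by (meson le_SucI less_SucI)
  then show ?thesis
    using v' that by (auto simp: world_bisim_def bounded_bisimilar_def)
qed

text \<open>Each step along the path spends one level, so level \<open>h\<close> transfers paths of
  length up to \<open>h\<close>. Path length thus becomes a way to tell worlds apart.\<close>

lemma world_bisim_path:
  assumes "world_bisim I P M h w v" "i \<in> I" "n \<le> h" "(w, w') \<in> rel M i ^^ n"
  shows "\<exists>v'. (v, v') \<in> rel M i ^^ n"
  using assms
proof (induction n arbitrary: h w v)
  case (Suc n)
  obtain u where u: "(w, u) \<in> rel M i" "(u, w') \<in> rel M i ^^ n"
    using Suc.prems(4) by (meson relpow_Suc_E2)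
  obtain h' where h: "h = Suc h'" "n \<le> h'"
    using Suc.prems(3) by (cases h) auto
  obtain u' where u': "(v, u') \<in> rel M i" "world_bisim I P M h' u u'"
    using Suc.prems(1)[unfolded h(1)] Suc.prems(2) u(1) by (rule world_bisim_forth)
  obtain v' where "(u', v') \<in> rel M i ^^ n"
    using Suc.IH[OF u'(2) Suc.prems(2) h(2) u(2)] by blast
  then show ?case
    using u'(1) by (meson relpow_Suc_I2)
qed auto

lemma bisim_class_eqD:
  assumes "is_model I P M" "v \<in> worlds M" "bisim_class I P M h w = bisim_class I P M h v"
  shows "world_bisim I P M h w v"
  using assms world_bisim_refl[OF assms(1,2), of h] by (auto simp: bisim_class_def)

lemma depth_le_iff:
  "depth I Mw w \<le> enat n \<longleftrightarrow>
     (\<exists>m\<le>n. (snd Mw, w) \<in> (\<Union>i\<in>I. rel (fst Mw) i) ^^ m)" (is "_ \<longleftrightarrow> (\<exists>m\<le>n. ?Q m)")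
proof
  assume le: "depth I Mw w \<le> enat n"
  define A where "A = enat ` Collect ?Q"
  \<comment> \<open>An infimum in \<open>enat\<close> over a nonempty set is a least element, hence
    attained by an actual path length; the empty case would give infinity, against
    \<open>le\<close>.\<close>
  have d: "depth I Mw w = (if A = {} then \<infinity> else LEAST x. x \<in> A)"
    by (simp only: depth_def Inf_enat_def A_def)
  then obtain x where "x \<in> A"
    using le by (cases "A = {}") auto
  then have "(LEAST x. x \<in> A) \<in> A"
    by (rule LeastI)
  then have "depth I Mw w \<in> A"
    using d \<open>x \<in> A\<close> by auto
  then show "\<exists>m\<le>n. ?Q m"
    using le unfolding A_def by force
next
  assume "\<exists>m\<le>n. ?Q m"
  then obtain m where m: "m \<le> n" "?Q m" by blast
  then have "depth I Mw w \<le> enat m"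
    unfolding depth_def by (intro INF_lower) auto
  then show "depth I Mw w \<le> enat n"
    using m(1) by (meson enat_ord_simps(1) order_trans)
qed

section \<open>The models\<close>

text \<open>The chain is \<open>0, \<dots>, k - 1\<close>, the root path is \<open>k, \<dots>, 2 * k\<close>, and \<open>Suc (2 * k) + m\<close> is the
  world of the subset of \<open>{..<k}\<close> with binary code \<open>m\<close>.\<close>

definition edges :: "nat \<Rightarrow> (nat \<times> nat) set" where
  "edges k =
     {(Suc j, j) | j. Suc j < k} \<union>
     {(k, j) | j. j < k} \<union>
     {(k + i, Suc (k + i)) | i. i < k} \<union>
     {(2 * k, Suc (2 * k) + m) | m. m < 2 ^ k} \<union>
     {(Suc (2 * k) + m, j) | m j. m < 2 ^ k \<and> j < k \<and> bit m j}"

text \<open>With one relation shared by all indices and every atom false everywhere, the same model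
  serves any nonempty \<open>I\<close> and any \<open>P\<close>; only the shape of the graph
  separates worlds.\<close>

definition subset_model :: "nat \<Rightarrow> (nat, 'i, 'p) model" where
  "subset_model k = \<lparr>worlds = {..<Suc (2 * k) + 2 ^ k}, rel = (\<lambda>_. edges k), val = (\<lambda>_. {})\<rparr>"

lemma subset_model_sel [simp]:
  "worlds (subset_model k) = {..<Suc (2 * k) + 2 ^ k}"
  "rel (subset_model k) i = edges k"
  "val (subset_model k) p = {}"
  by (simp_all add: subset_model_def)

lemma is_model_subset_model: "is_model I P (subset_model k)"
  by (auto simp: is_model_def edges_def lessThan_empty_iff)

lemma is_pointed_model_subset_model: "is_pointed_model I P (subset_model k, k)"
  by (simp add: is_pointed_model_def is_model_subset_model)

lemma chain_path: "n \<le> j \<Longrightarrow> j < k \<Longrightarrow> (j, j - n) \<in> edges k ^^ n"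
proof (induction n)
  case (Suc n)
  then have "(j - n, j - Suc n) \<in> edges k"
    unfolding edges_def by (auto simp: Suc_diff_Suc intro!: exI[of _ "j - Suc n"])
  then show ?case
    using Suc by (auto intro: relpow_Suc_I)
qed auto

text \<open>The only edge out of a positive chain world goes to its predecessor, and
  \<open>0\<close> has none. With \<open>chain_path\<close>, the longest path from \<open>j\<close>
  has length exactly \<open>j\<close>.\<close>

lemma chain_path_length_le: "(j, v) \<in> edges k ^^ n \<Longrightarrow> j < k \<Longrightarrow> n \<le> j"
proof (induction n arbitrary: j)
  case (Suc n)
  then obtain u where u: "(j, u) \<in> edges k" "(u, v) \<in> edges k ^^ n"
    by (meson relpow_Suc_E2)
  then have "j = Suc u"
    using Suc.prems(2) by (auto simp: edges_def)
  then show ?case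
    using Suc u(2) by auto
qed auto

lemma root_path: "n \<le> k \<Longrightarrow> (k, k + n) \<in> edges k ^^ n"
proof (induction n)
  case (Suc n)
  then have "(k + n, k + Suc n) \<in> edges k"
    by (auto simp: edges_def)
  then show ?case
    using Suc by (auto intro: relpow_Suc_I)
qed auto

text \<open>The chain is never left once entered, and the subset worlds are entered only from
  \<open>2 * k\<close>, which takes \<open>k\<close> steps to reach.\<close>

lemma root_path_end: "(k, w) \<in> edges k ^^ n \<Longrightarrow> n \<le> k \<Longrightarrow> w < k \<or> w = k + n"
proof (induction n arbitrary: w)
  case (Suc n)
  then obtain u where u: "(k, u) \<in> edges k ^^ n" "(u, w) \<in> edges k"
    by (meson relpow_Suc_E)
  then have "u < k \<or> u = k + n"
    using Suc by auto
  then show ?case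
    using u(2) Suc.prems(2) by (auto simp: edges_def)
qed auto

lemma chain_not_bisim_longer:
  assumes "I \<noteq> {}" "j < n" "n \<le> h" "j < k" "(w, w') \<in> edges k ^^ n"
  shows "\<not> world_bisim I P (subset_model k) h w j"
proof
  assume *: "world_bisim I P (subset_model k) h w j"
  obtain i where "i \<in> I" using assms(1) by blast
  then obtain v where "(j, v) \<in> edges k ^^ n"
    using world_bisim_path[OF * _ assms(3)] assms(5) unfolding subset_model_sel by blast
  then show False
    using chain_path_length_le assms by fastforce
qed

text \<open>The larger world has a path down to \<open>0\<close> that is too long for the smaller
  one, and its length is at most \<open>k - 1\<close>. Level \<open>k - 1\<close> is what remains
  one step below a subset world at level \<open>k\<close>, and it is also the bound of chain
  worlds.\<close>

lemma chain_bisim_eq: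
  assumes "I \<noteq> {}" "world_bisim I P (subset_model k) (k - 1) i j" "i < k" "j < k"
  shows "i = j"
proof -
  have neq: "\<not> world_bisim I P (subset_model k) (k - 1) b a" if "a < b" "b < k" for a b
    using that by (intro chain_not_bisim_longer[OF assms(1) _ _ _ chain_path[of b b k]]) auto
  show ?thesis
    using neq[of i j] neq[of j i] assms world_bisim_sym[OF assms(2)]
    by (cases i j rule: linorder_cases) auto
qed

text \<open>The step to \<open>j\<close> must be matched by a chain world bisimilar to
  \<open>j\<close> at level \<open>k - 1\<close>, which can only be \<open>j\<close> itself.\<close>

lemma subset_bisim_bit:
  assumes "I \<noteq> {}" "world_bisim I P (subset_model k) k (Suc (2 * k) + m) (Suc (2 * k) + n)"
    and "m < 2 ^ k" "j < k" "bit m j"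
  shows "bit n j"
proof -
  obtain i where i: "i \<in> I" using assms(1) by blast
  have "world_bisim I P (subset_model k) (Suc (k - 1)) (Suc (2 * k) + m) (Suc (2 * k) + n)"
    using assms(2,4) by simp
  moreover have "(Suc (2 * k) + m, j) \<in> rel (subset_model k) i"
    using assms by (auto simp: edges_def)
  ultimately obtain j' where j': "(Suc (2 * k) + n, j') \<in> edges k"
    "world_bisim I P (subset_model k) (k - 1) j j'"
    using i by (metis world_bisim_forth subset_model_sel(2))
  then have "j' < k" "bit n j'"
    by (auto simp: edges_def)
  then show ?thesis
    using chain_bisim_eq[OF assms(1) j'(2) assms(4)] by simp
qed

lemma subset_bisim_eq:
  assumes "I \<noteq> {}" "world_bisim I P (subset_model k) k (Suc (2 * k) + m) (Suc (2 * k) + n)"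
    and "m < 2 ^ k" "n < 2 ^ k"
  shows "m = n"
proof -
  \<comment> \<open>Bits are compared only at positions below \<open>k\<close>; codes less than
    \<open>2 ^ k\<close> have no others.\<close>
  have "take_bit k m = take_bit k n"
    using subset_bisim_bit[OF assms(1,2,3)]
      subset_bisim_bit[OF assms(1) world_bisim_sym[OF assms(2)] assms(4)]
    by (auto simp: bit_eq_iff bit_take_bit_iff)
  then show ?thesis
    using assms(3,4) by (simp add: take_bit_nat_eq_self)
qed

section \<open>Sizes of the contractions\<close>

lemma card_standard_contraction:
  assumes "I \<noteq> {}"
  shows "2 ^ k \<le> card (worlds (fst (standard_contraction I P k (subset_model k, k))))"
    and "card (worlds (fst (standard_contraction I P k (subset_model k, k)))) \<le> Suc (2 * k) + 2 ^ k"
proof -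
  let ?M = "subset_model k :: (nat, 'a, 'b) model"
  let ?c = "bisim_class I P ?M k"
  have W: "worlds (fst (standard_contraction I P k (?M, k))) = ?c ` {..<Suc (2 * k) + 2 ^ k}"
    by (auto simp: standard_contraction_def Let_def)
  have "inj_on (\<lambda>m. ?c (Suc (2 * k) + m)) {..<2 ^ k}"
  proof (rule inj_onI)
    fix m n :: nat
    assume "m \<in> {..<2 ^ k}" "n \<in> {..<2 ^ k}" "?c (Suc (2 * k) + m) = ?c (Suc (2 * k) + n)"
    then show "m = n"
      by (intro subset_bisim_eq[OF assms(1)] bisim_class_eqD[OF is_model_subset_model]) auto
  qed
  moreover have "(\<lambda>m. ?c (Suc (2 * k) + m)) ` {..<2 ^ k} \<subseteq> ?c ` {..<Suc (2 * k) + 2 ^ k}"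
    by auto
  ultimately have "card {..<2 ^ k :: nat} \<le> card (?c ` {..<Suc (2 * k) + 2 ^ k})"
    by (intro card_inj_on_le) auto
  then show "2 ^ k \<le> card (worlds (fst (standard_contraction I P k (?M, k))))"
    by (simp only: W card_lessThan)
  show "card (worlds (fst (standard_contraction I P k (?M, k)))) \<le> Suc (2 * k) + 2 ^ k"
    unfolding W using card_image_le[of "{..<Suc (2 * k) + 2 ^ k}" ?c] by simp
qed

lemma depth_subset_model_le_iff:
  assumes "I \<noteq> {}"
  shows "depth I (subset_model k, k) w \<le> enat n \<longleftrightarrow> (\<exists>m\<le>n. (k, w) \<in> edges k ^^ m)"
  using assms by (simp add: depth_le_iff)

lemma max_worlds_subset:
  assumes "I \<noteq> {}"
  shows "max_worlds I P k (subset_model k, k) \<subseteq> {..2 * k}"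
proof
  fix x
  assume "x \<in> max_worlds I P k (subset_model k, k)"
  then obtain m where "m \<le> k" "(k, x) \<in> edges k ^^ m"
    by (auto simp: max_worlds_def nonneg_bound_def depth_subset_model_le_iff[OF assms])
  then show "x \<in> {..2 * k}"
    using root_path_end by fastforce
qed

lemma depth_chain:
  assumes "I \<noteq> {}" "j < k"
  shows "depth I (subset_model k, k) j = enat 1" (is "?d = _")
proof (rule antisym)
  have "(k, j) \<in> edges k ^^ 1"
    using assms by (auto simp: edges_def)
  then show "?d \<le> enat 1"
    using depth_subset_model_le_iff[OF assms(1)] by blast
  have "\<not> ?d \<le> enat 0"
    using assms by (auto simp: depth_subset_model_le_iff)
  then show "enat 1 \<le> ?d"
    by (cases ?d) auto
qed

lemma bound_chain: "I \<noteq> {} \<Longrightarrow> j < k \<Longrightarrow> bound I k (subset_model k, k) j = k - 1"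
  by (simp add: bound_def depth_chain)

text \<open>Only the root has a bound above \<open>k - 1\<close>, and its path of length
  \<open>k - 1\<close> along the root path is longer than any path from \<open>j\<close>; hence the
  strict \<open>j < k - 1\<close>.\<close>

lemma chain_max_worlds:
  assumes "I \<noteq> {}" "j < k - 1"
  shows "j \<in> max_worlds I P k (subset_model k, k)"
proof -
  let ?M = "subset_model k :: (nat, 'a, 'b) model"
  have "\<not> outranks I P k (?M, k) y j" for y
  proof
    assume out: "outranks I P k (?M, k) y j"
    then have nonneg: "depth I (?M, k) y \<le> enat k" and "bound I k (?M, k) y > k - 1"
      and bisim: "world_bisim I P ?M (k - 1) y j"
      using assms by (simp_all add: outranks_def nonneg_bound_def bound_chain)
    then have "the_enat (depth I (?M, k) y) = 0"
      by (simp add: bound_def)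
    \<comment> \<open>The value of \<open>the_enat\<close> at infinity is unspecified, so
      \<open>nonneg\<close> first rules out an unreachable \<open>y\<close>.\<close>
    then have "depth I (?M, k) y \<le> enat 0"
      using nonneg by (cases "depth I (?M, k) y") auto
    then have "y = k"
      by (auto simp: depth_subset_model_le_iff[OF assms(1)])
    moreover have "\<not> world_bisim I P ?M (k - 1) k j"
      using assms by (intro chain_not_bisim_longer[OF _ _ _ _ root_path[of "k - 1" k]]) auto
    ultimately show False
      using bisim by simp
  qed
  then show ?thesis
    using assms by (auto simp: max_worlds_def nonneg_bound_def depth_chain)
qed

lemma card_rooted_contraction:
  assumes "I \<noteq> {}"
  shows "k - 1 \<le> card (worlds (fst (rooted_contraction I P k (subset_model k, k))))"
    and "card (worlds (fst (rooted_contraction I P k (subset_model k, k)))) \<le> Suc (2 * k)"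
proof -
  let ?M = "subset_model k :: (nat, 'a, 'b) model"
  let ?X = "max_worlds I P k (?M, k)"
  let ?c = "\<lambda>x. bisim_class I P ?M (bound I k (?M, k) x) x"
  have W: "worlds (fst (rooted_contraction I P k (?M, k))) = ?c ` ?X"
    by (auto simp: rooted_contraction_def Let_def)
  have X: "?X \<subseteq> {..2 * k}" and fin: "finite ?X"
    using max_worlds_subset[OF assms] finite_subset by blast+
  have "inj_on ?c {..<k - 1}"
  proof (rule inj_onI)
    fix i j
    assume ij: "i \<in> {..<k - 1}" "j \<in> {..<k - 1}" "?c i = ?c j"
    \<comment> \<open>Chain worlds share one bound, so the two classes are taken at the same
      level.\<close>
    then have "bisim_class I P ?M (k - 1) i = bisim_class I P ?M (k - 1) j"
      using assms by (simp add: bound_chain)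
    then have "world_bisim I P ?M (k - 1) i j"
      using ij by (intro bisim_class_eqD[OF is_model_subset_model]) auto
    then show "i = j"
      using ij by (intro chain_bisim_eq[OF assms(1), of P k]) auto
  qed
  moreover have "?c ` {..<k - 1} \<subseteq> ?c ` ?X"
    using chain_max_worlds[OF assms] by blast
  ultimately have "card {..<k - 1} \<le> card (?c ` ?X)"
    using fin by (intro card_inj_on_le) auto
  then show "k - 1 \<le> card (worlds (fst (rooted_contraction I P k (?M, k))))"
    by (simp only: W card_lessThan)
  have "card (?c ` ?X) \<le> card {..2 * k}"
    using card_image_le[OF fin] card_mono[OF _ X] by (meson finite_atMost order_trans)
  then show "card (worlds (fst (rooted_contraction I P k (?M, k)))) \<le> Suc (2 * k)"
    by (simp only: W card_atMost)
qed

theorem theorem6p2: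
  fixes I :: "'i set" and P :: "'p set"
  assumes "finite I" and "I \<noteq> {}" and "countable P"
  shows "\<exists>M :: nat \<Rightarrow> (nat, 'i, 'p) pointed.
           (\<forall>k. is_pointed_model I P (M k)) \<and>
           (\<lambda>k. real (card (worlds (fst (rooted_contraction I P k (M k))))))
              \<in> \<Theta>(\<lambda>k. real k) \<and>
           (\<lambda>k. real (card (worlds (fst (standard_contraction I P k (M k))))))
              \<in> \<Theta>(\<lambda>k. 2 ^ k)"
proof (intro exI conjI allI)
  let ?M = "\<lambda>k. (subset_model k, k) :: (nat, 'i, 'p) pointed"
  let ?r = "\<lambda>k. card (worlds (fst (rooted_contraction I P k (?M k))))"
  let ?s = "\<lambda>k. card (worlds (fst (standard_contraction I P k (?M k))))"
  show "is_pointed_model I P (?M k)" for k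
    by (rule is_pointed_model_subset_model)
  show "(\<lambda>k. real (?r k)) \<in> \<Theta>(\<lambda>k. real k)"
  proof (rule bigthetaI)
    have "real (?r k) \<le> 3 * real k" if "k \<ge> 1" for k
      using card_rooted_contraction(2)[OF assms(2), of P k] that by linarith
    then show "(\<lambda>k. real (?r k)) \<in> O(\<lambda>k. real k)"
      by (intro bigoI[of _ 3] eventually_sequentiallyI[of 1]) auto
    have "1 / 2 * real k \<le> real (?r k)" if "k \<ge> 2" for k
      using card_rooted_contraction(1)[OF assms(2), of k P] that by linarith
    then show "(\<lambda>k. real (?r k)) \<in> \<Omega>(\<lambda>k. real k)"
      by (intro landau_omega.bigI[of "1 / 2"] eventually_sequentiallyI[of 2]) auto
  qed
  show "(\<lambda>k. real (?s k)) \<in> \<Theta>(\<lambda>k. 2 ^ k)"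
  proof (rule bigthetaI)
    have "real (?s k) \<le> 4 * 2 ^ k" for k
    proof -
      \<comment> \<open>Since \<open>k < 2 ^ k\<close>, the linear term \<open>Suc (2 * k)\<close>
        is below \<open>2 * 2 ^ k\<close>.\<close>
      have "?s k \<le> 4 * 2 ^ k"
        using card_standard_contraction(2)[OF assms(2), of P k] less_exp[of k] by linarith
      then show ?thesis
        using of_nat_mono by fastforce
    qed
    then show "(\<lambda>k. real (?s k)) \<in> O(\<lambda>k. 2 ^ k)"
      by (intro bigoI[of _ 4] always_eventually) auto
    have "2 ^ k \<le> real (?s k)" for k
      by (simp add: card_standard_contraction(1)[OF assms(2)])
    then show "(\<lambda>k. real (?s k)) \<in> \<Omega>(\<lambda>k. 2 ^ k)"
      by (intro landau_omega.bigI[of 1] always_eventually) auto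
  qed
qed

end
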